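(* Let $f\in\{u,d\}$, $\delta=\sqrt{3/8}$, $s_d=1$, $s_u=\tfrac23$, and $(a_f,b_f,c_f)=(s_f-\delta,\,s_f,\,s_f+\delta)$. Let $\widehat X_f$ be the operator on $V_f=\mathbb C^3$, with orthonormal basis $|a\rangle,|b\rangle,|c\rangle$, given by $\widehat X_f=a_f|a\rangle\langle a|+b_f|b\rangle\langle b|+c_f|c\rangle\langle c|$, and let $\Gamma_3(\widehat X_f)$ be the restriction of $\widehat X_f^{\otimes 3}$ to $\mathrm{Sym}^3(V_f)$, with normalized occupation states $|pqr\rangle$, $p+q+r=3$. Let the occupied-node projectors be $$P^d_{\rm occ}=|210\rangle\langle210|+|111\rangle\langle111|+|003\rangle\langle003|,\qquad P^u_{\rm occ}=|210\rangle\langle210|+|111\rangle\langle111|+|021\rangle\langle021|,$$ and define $\mathcal R_f$ as the restriction of $P^f_{\rm occ}\Gamma_3(\widehat X_f)P^f_{\rm occ}$ to the three-dimensional space $P^f_{\rm occ}\mathrm{Sym}^3(V_f)$. Then, in the ordered basis $(|210\rangle,|111\rangle,|003\rangle)$ for $f=d$ and the ordered basis $(|210\rangle,|111\rangle,|021\rangle)$ for $f=u$, $$\mathcal R_d=\operatorname{diag}(a_d^2b_d,\;a_db_dc_d,\;c_d^3),\qquad \mathcal R_u=\operatorname{diag}(a_u^2b_u,\;a_ub_uc_u,\;b_u^2c_u).$$ Moreover, let $\rho_{f3}$ be the largest eigenvalue of $\mathcal R_f$ and $\mathcal Q_f=\mathcal R_f^\dagger\mathcal R_f/\rho_{f3}^2$.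 If $m_{f1},m_{f2},m_{f3}>0$ are masses such that $(\sqrt{m_{f1}},\sqrt{m_{f2}},\sqrt{m_{f3}})$ is proportional to $(a_d^2b_d,a_db_dc_d,c_d^3)$ for $f=d$, respectively to $(a_u^2b_u,a_ub_uc_u,b_u^2c_u)$ for $f=u$, then $$\operatorname{spec}\mathcal Q_f=\left(\frac{m_{f1}}{m_{f3}},\frac{m_{f2}}{m_{f3}},1\right).$$
   Context: For nonnegative integers $p+q+r=3$, $|pqr\rangle\in\mathrm{Sym}^3(V_f)$ denotes the unit vector obtained by normalizing the symmetrization of $|a\rangle^{\otimes p}\otimes|b\rangle^{\otimes q}\otimes|c\rangle^{\otimes r}$; these ten vectors form an orthonormal basis of $\mathrm{Sym}^3(V_f)$. The rule that the square-root masses of the three generations of sector $f$ are proportional to the three monomials $(a_d^2b_d,a_db_dc_d,c_d^3)$ for $f=d$, respectively $(a_u^2b_u,a_ub_uc_u,b_u^2c_u)$ for $f=u$, in that order, is the adopted "root-mass convention". *)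

theory Defs
  imports "HOL-Analysis.Analysis"
begin

text \<open>The inner product of \<^typ>\<open>complex^'n\<close> in the library is real valued; the sesquilinear one is
  defined here, antilinear in the first argument. Its norm is the library's norm. Complex subspaces,
  spans and dimensions are those of the library's scalar multiplication \<open>(*s)\<close>.\<close>

definition cinner :: "complex^'n \<Rightarrow> complex^'n \<Rightarrow> complex" where
  "cinner x y = (\<Sum>i\<in>UNIV. cnj (x $ i) * y $ i)"

definition ketbra :: "complex^'n \<Rightarrow> complex^'n \<Rightarrow> complex^'n \<Rightarrow> complex^'n" where
  "ketbra u v = (\<lambda>x. cinner v x *s u)"

definition orthonormal_basis :: "(complex^'n) set \<Rightarrow> (complex^'n)^3 \<Rightarrow> bool" where
  "orthonormal_basis W B \<longleftrightarrow>
     (\<forall>i j. cinner (B $ i) (B $ j) = (if i = j then 1 else 0)) \<and> vec.span (range (($) B)) = W"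

definition lincomb :: "(complex^'n)^3 \<Rightarrow> complex^3 \<Rightarrow> complex^'n" where
  "lincomb B x = (\<Sum>i\<in>UNIV. x $ i *s B $ i)"

text \<open>\<open>M\<close> is the matrix of \<open>T\<close> in the ordered basis \<open>B\<close> (of an invariant subspace).\<close>

definition represented_by ::
    "(complex^'n)^3 \<Rightarrow> (complex^'n \<Rightarrow> complex^'n) \<Rightarrow> complex^3^3 \<Rightarrow> bool" where
  "represented_by B T M \<longleftrightarrow> (\<forall>x. T (lincomb B x) = lincomb B (M *v x))"

definition diag :: "'a::zero^'n \<Rightarrow> 'a^'n^'n" where
  "diag d = (\<chi> i j. if i = j then d $ i else 0)"

text \<open>An operator on a subspace \<open>W\<close> is a function that is \<^const>\<open>undefined\<close> outside \<open>W\<close>, so that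
  the adjoint below is unique.\<close>

definition adjoint_on ::
    "(complex^'n) set \<Rightarrow> (complex^'n \<Rightarrow> complex^'n) \<Rightarrow> complex^'n \<Rightarrow> complex^'n" where
  "adjoint_on W T =
     (THE S. S \<in> W \<rightarrow>\<^sub>E W \<and> (\<forall>x\<in>W. \<forall>y\<in>W. cinner (S x) y = cinner x (T y)))"

definition eigenspace ::
    "(complex^'n) set \<Rightarrow> (complex^'n \<Rightarrow> complex^'n) \<Rightarrow> complex \<Rightarrow> (complex^'n) set" where
  "eigenspace W T \<mu> = {x \<in> W. T x = \<mu> *s x}"

definition eigenvalue_on ::
    "(complex^'n) set \<Rightarrow> (complex^'n \<Rightarrow> complex^'n) \<Rightarrow> complex \<Rightarrow> bool" where
  "eigenvalue_on W T \<mu> \<longleftrightarrow> (\<exists>x \<in> eigenspace W T \<mu>. x \<noteq> 0)"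

definition largest_eigenvalue ::
    "(complex^'n) set \<Rightarrow> (complex^'n \<Rightarrow> complex^'n) \<Rightarrow> real" where
  "largest_eigenvalue W T = Max {r. eigenvalue_on W T (complex_of_real r)}"

text \<open>The spectrum of a self-adjoint operator on \<open>W\<close> as a tuple: all its eigenvalues, repeated
  according to multiplicity, in increasing order. Multiplicities are geometric, and the length condition
  says that the eigenspaces exhaust \<open>W\<close>, so there is no defect.\<close>

definition has_spec ::
    "(complex^'n) set \<Rightarrow> (complex^'n \<Rightarrow> complex^'n) \<Rightarrow> real list \<Rightarrow> bool" where
  "has_spec W T rs \<longleftrightarrow>
     sorted rs \<and> length rs = vec.dim W \<and>
     (\<forall>\<mu>. vec.dim (eigenspace W T \<mu>) = count_list (map complex_of_real rs) \<mu>)"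

text \<open>The threefold tensor power of \<^typ>\<open>complex^3\<close> is \<^typ>\<open>complex^(3 \<Rightarrow> 3)\<close>: a basis tensor is
  given by a function from the three tensor factors to the three coordinates.\<close>

type_synonym tensor3 = "complex^(3 \<Rightarrow> 3)"

definition tensor :: "(complex^3)^3 \<Rightarrow> tensor3" where
  "tensor v = (\<chi> i. \<Prod>k\<in>UNIV. v $ k $ i k)"

text \<open>Linear extension of \<open>v\<^sub>1 \<otimes> v\<^sub>2 \<otimes> v\<^sub>3 \<mapsto> X v\<^sub>1 \<otimes> X v\<^sub>2 \<otimes> X v\<^sub>3\<close> from the basis tensors.\<close>

definition tensor_power3 :: "(complex^3 \<Rightarrow> complex^3) \<Rightarrow> tensor3 \<Rightarrow> tensor3" where
  "tensor_power3 X t = (\<Sum>i\<in>UNIV. t $ i *s tensor (\<chi> k. X (axis (i k) 1)))"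

lemma tensor_power3_tensor:
  assumes "Vector_Spaces.linear (*s) (*s) X"
  shows "tensor_power3 X (tensor v) = tensor (\<chi> k. X (v $ k))"
proof -
  have X: "X u = (\<Sum>j\<in>UNIV. u $ j *s X (axis j 1))" for u
  proof -
    have "X u = X (\<Sum>j\<in>UNIV. u $ j *s axis j 1)"
      by (simp add: basis_expansion)
    also have "\<dots> = (\<Sum>j\<in>UNIV. u $ j *s X (axis j 1))"
      using assms by (simp add: vec.linear_sum vec.linear_scale)
    finally show ?thesis .
  qed
  have "tensor (\<chi> k. X (v $ k)) $ l = tensor_power3 X (tensor v) $ l" for l
  proof -
    have "tensor (\<chi> k. X (v $ k)) $ l
        = (\<Prod>k\<in>UNIV. \<Sum>j\<in>UNIV. v $ k $ j * X (axis j 1) $ l k)"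
      unfolding tensor_def by (subst X) simp
    also have "\<dots> = (\<Sum>i\<in>UNIV. \<Prod>k\<in>UNIV. v $ k $ i k * X (axis (i k) 1) $ l k)"
      by (subst prod_sum_PiE) (simp_all add: PiE_UNIV_domain)
    finally show ?thesis
      by (simp add: tensor_power3_def tensor_def prod.distrib)
  qed
  thus ?thesis by (simp add: vec_eq_iff)
qed

definition permute_tensor :: "(3 \<Rightarrow> 3) \<Rightarrow> tensor3 \<Rightarrow> tensor3" where
  "permute_tensor \<sigma> t = (\<chi> i. t $ (i \<circ> \<sigma>))"

definition Sym3 :: "tensor3 set" where
  "Sym3 = {t. \<forall>\<sigma>. \<sigma> permutes UNIV \<longrightarrow> permute_tensor \<sigma> t = t}"

definition symmetrize :: "tensor3 \<Rightarrow> tensor3" where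
  "symmetrize t = (1 / fact 3) *s (\<Sum>\<sigma> | \<sigma> permutes UNIV. permute_tensor \<sigma> t)"

definition Gamma3 :: "(complex^3 \<Rightarrow> complex^3) \<Rightarrow> tensor3 \<Rightarrow> tensor3" where
  "Gamma3 X = restrict (tensor_power3 X) Sym3"

text \<open>The occupation state \<open>|pqr\<rangle>\<close> over a basis \<open>E\<close> of \<^typ>\<open>complex^3\<close>, for \<open>p + q + r = 3\<close>.\<close>

definition occ_state :: "(complex^3)^3 \<Rightarrow> nat \<Rightarrow> nat \<Rightarrow> nat \<Rightarrow> tensor3" where
  "occ_state E p q r =
     (let t = symmetrize (tensor (vector
                (replicate p (E $ 1) @ replicate q (E $ 2) @ replicate r (E $ 3))))
      in t /\<^sub>R norm t)"

text \<open>Below, \<open>E\<close> is the orthonormal basis \<open>|a\<rangle>, |b\<rangle>, |c\<rangle>\<close> of the one-particle space.\<close>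

datatype sector = Up | Down

definition delta :: real where
  "delta = sqrt (3 / 8)"

fun centre :: "sector \<Rightarrow> real" where
  "centre Down = 1"
| "centre Up = 2 / 3"

definition node_a :: "sector \<Rightarrow> real" where "node_a f = centre f - delta"
definition node_b :: "sector \<Rightarrow> real" where "node_b f = centre f"
definition node_c :: "sector \<Rightarrow> real" where "node_c f = centre f + delta"

definition X_op :: "sector \<Rightarrow> (complex^3)^3 \<Rightarrow> complex^3 \<Rightarrow> complex^3" where
  "X_op f E = (\<lambda>x. complex_of_real (node_a f) *s ketbra (E $ 1) (E $ 1) x
                 + complex_of_real (node_b f) *s ketbra (E $ 2) (E $ 2) x
                 + complex_of_real (node_c f) *s ketbra (E $ 3) (E $ 3) x)"

fun occ_basis :: "sector \<Rightarrow> (complex^3)^3 \<Rightarrow> tensor3^3" where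
  "occ_basis Down E = vector [occ_state E 2 1 0, occ_state E 1 1 1, occ_state E 0 0 3]"
| "occ_basis Up E = vector [occ_state E 2 1 0, occ_state E 1 1 1, occ_state E 0 2 1]"

definition P_occ :: "sector \<Rightarrow> (complex^3)^3 \<Rightarrow> tensor3 \<Rightarrow> tensor3" where
  "P_occ f E = (\<lambda>x. \<Sum>i\<in>UNIV. ketbra (occ_basis f E $ i) (occ_basis f E $ i) x)"

definition occ_space :: "sector \<Rightarrow> (complex^3)^3 \<Rightarrow> tensor3 set" where
  "occ_space f E = P_occ f E ` Sym3"

definition R_op :: "sector \<Rightarrow> (complex^3)^3 \<Rightarrow> tensor3 \<Rightarrow> tensor3" where
  "R_op f E = restrict (P_occ f E \<circ> Gamma3 (X_op f E) \<circ> P_occ f E) (occ_space f E)"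

definition rho :: "sector \<Rightarrow> (complex^3)^3 \<Rightarrow> real" where
  "rho f E = largest_eigenvalue (occ_space f E) (R_op f E)"

definition Q_op :: "sector \<Rightarrow> (complex^3)^3 \<Rightarrow> tensor3 \<Rightarrow> tensor3" where
  "Q_op f E = restrict
     (\<lambda>x. complex_of_real (1 / (rho f E)\<^sup>2) *s adjoint_on (occ_space f E) (R_op f E) (R_op f E x))
     (occ_space f E)"

text \<open>The square-root masses of the three generations are proportional to these, in this order.\<close>

fun monomials :: "sector \<Rightarrow> real^3" where
  "monomials Down = vector
     [(node_a Down)\<^sup>2 * node_b Down, node_a Down * node_b Down * node_c Down, (node_c Down) ^ 3]"
| "monomials Up = vector
     [(node_a Up)\<^sup>2 * node_b Up, node_a Up * node_b Up * node_c Up, (node_b Up)\<^sup>2 * node_c Up]"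

end

theory Submission
  imports Defs
begin

text \<open>The symmetrized basis tensors are eigenvectors of \<open>X \<otimes> X \<otimes> X\<close>, the eigenvalue being the product of
  the occupied nodes, and two of them are orthogonal as soon as they occupy different sets of modes,
  which is the case for the three states of each sector. Hence the compression to the occupied space is
  diagonal with real entries, so it is its own adjoint, and its square has the squared monomials as
  eigenvalues. These are increasing because \<open>0 < a < b < c\<close>.\<close>

section \<open>The sesquilinear inner product\<close>

lemma cinner_add_right: "cinner x (y + z) = cinner x y + cinner x z"
  by (simp add: cinner_def algebra_simps sum.distrib)

lemma cinner_scale_right: "cinner x (c *s y) = c * cinner x y"
  by (simp add: cinner_def algebra_simps sum_distrib_left)

lemma cinner_zero_right: "cinner x 0 = 0"
  by (simp add: cinner_def)

lemma cinner_sum_right: "cinner x (\<Sum>i\<in>A. f i) = (\<Sum>i\<in>A. cinner x (f i))"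
  by (induction A rule: infinite_finite_induct) (simp_all add: cinner_add_right cinner_zero_right)

lemma cinner_commute: "cinner y x = cnj (cinner x y)"
  by (simp add: cinner_def mult.commute)

lemma cinner_scale_left: "cinner (c *s x) y = cnj c * cinner x y"
  by (subst cinner_commute) (simp add: cinner_scale_right flip: cinner_commute)

lemma cinner_sum_left: "cinner (\<Sum>i\<in>A. f i) y = (\<Sum>i\<in>A. cinner (f i) y)"
  by (subst cinner_commute) (simp add: cinner_sum_right flip: cinner_commute)

lemma cinner_diff_left: "cinner (x - y) z = cinner x z - cinner y z"
  by (simp add: cinner_def algebra_simps sum_subtractf)

text \<open>This link to the library norm gives both the unit length of the occupation states and
  the definiteness behind the uniqueness of the adjoint.\<close>

lemma cinner_self: "cinner x x = complex_of_real ((norm x)\<^sup>2)"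
proof -
  have "(norm x)\<^sup>2 = (\<Sum>i\<in>UNIV. (norm (x $ i))\<^sup>2)"
    by (simp add: norm_vec_def L2_set_def sum_nonneg)
  thus ?thesis
    by (simp add: cinner_def complex_norm_square mult.commute del: of_real_power)
qed

text \<open>By minimality of the span, orthogonality to a generating set extends to everything it
  spans.\<close>

lemma subspace_orthogonal: "vec.subspace {x. cinner y x = 0}"
  by (simp add: vec.subspace_def cinner_add_right cinner_scale_right cinner_zero_right)

lemma scaleR_eq_scale: "r *\<^sub>R x = complex_of_real r *s (x :: complex^'n)"
  by (simp add: vec_eq_iff scaleR_conv_of_real[where 'a=complex])

section \<open>Orthonormal systems and diagonal operators\<close>

text \<open>Coordinates for every vector of the space, so that \<open>represented_by\<close> fixes
  the operator on all of it.\<close>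

lemma span_range_eq_range_lincomb: "vec.span (range (($) B)) = range (lincomb B)"
proof
  have "vec.subspace (range (lincomb B))"
    unfolding vec.subspace_def
  proof (intro conjI ballI allI)
    have "lincomb B 0 = 0" by (simp add: lincomb_def)
    thus "0 \<in> range (lincomb B)" by (metis rangeI)
  next
    fix x y assume "x \<in> range (lincomb B)" "y \<in> range (lincomb B)"
    then obtain c d where "x = lincomb B c" "y = lincomb B d" by auto
    hence "x + y = lincomb B (c + d)"
      by (simp add: lincomb_def sum.distrib vec.scale_left_distrib)
    thus "x + y \<in> range (lincomb B)" by simp
  next
    fix k x assume "x \<in> range (lincomb B)"
    then obtain c where "x = lincomb B c" by auto
    hence "k *s x = lincomb B (k *s c)"
      by (simp add: lincomb_def vec.scale_sum_right)
    thus "k *s x \<in> range (lincomb B)" by simp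
  qed
  moreover have "B $ i = lincomb B (axis i 1)" for i
  proof -
    have "lincomb B (axis i 1) = (\<Sum>j\<in>UNIV. if j = i then B $ j else 0)"
      unfolding lincomb_def by (rule sum.cong) (auto simp: axis_def)
    thus ?thesis by simp
  qed
  hence "range (($) B) \<subseteq> range (lincomb B)" by blast
  ultimately show "vec.span (range (($) B)) \<subseteq> range (lincomb B)"
    by (rule vec.span_minimal[rotated])
next
  show "range (lincomb B) \<subseteq> vec.span (range (($) B))"
    unfolding lincomb_def
    by (intro image_subsetI vec.span_sum vec.span_scale vec.span_base rangeI)
qed

context
  fixes B :: "(complex^'n)^3"
  assumes orthonormal: "\<And>i j. cinner (B $ i) (B $ j) = (if i = j then 1 else 0)"
begin

lemma cinner_lincomb: "cinner (B $ i) (lincomb B x) = x $ i"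
  by (simp add: lincomb_def cinner_sum_right cinner_scale_right orthonormal
      if_distrib[of "\<lambda>t. _ * t"] cong: if_cong)

lemma lincomb_eq_iff: "lincomb B x = lincomb B y \<longleftrightarrow> x = y"
  by (metis cinner_lincomb vec_eq_iff)

lemma cinner_lincomb_lincomb:
  "cinner (lincomb B x) (lincomb B y) = (\<Sum>i\<in>UNIV. cnj (x $ i) * y $ i)"
  by (subst lincomb_def) (simp add: cinner_sum_left cinner_scale_left cinner_lincomb)

lemma projection_eq_lincomb:
  "(\<Sum>i\<in>UNIV. ketbra (B $ i) (B $ i) x) = lincomb B (\<chi> i. cinner (B $ i) x)"
  by (simp add: ketbra_def lincomb_def)

lemma projection_lincomb:
  "(\<Sum>i\<in>UNIV. ketbra (B $ i) (B $ i) (lincomb B x)) = lincomb B x"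
  by (simp add: projection_eq_lincomb cinner_lincomb)

lemma inj_orthonormal: "inj (($) B)"
  using orthonormal by (auto simp: inj_def) (metis zero_neq_one)

text \<open>Anything spanned by the other vectors is orthogonal to \<open>B $ i\<close>, which is
  not orthogonal to itself.\<close>

lemma independent_orthonormal: "vec.independent (($) B ` S)"
  unfolding vec.dependent_def
proof
  assume "\<exists>a\<in>($) B ` S. a \<in> vec.span (($) B ` S - {a})"
  then obtain i where i: "B $ i \<in> vec.span (($) B ` S - {B $ i})" by auto
  have "vec.span (($) B ` S - {B $ i}) \<subseteq> {x. cinner (B $ i) x = 0}"
    by (rule vec.span_minimal[OF _ subspace_orthogonal]) (auto simp: orthonormal)
  with i have "cinner (B $ i) (B $ i) = 0" by blast
  thus False by (simp add: orthonormal)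
qed

lemma dim_span_orthonormal: "vec.dim (vec.span (($) B ` S)) = card S"
  using vec.dim_eq_card_independent[OF independent_orthonormal]
  by (simp add: card_image inj_on_subset[OF inj_orthonormal])

end

section \<open>Eigenspaces, adjoint and spectrum of a diagonal operator\<close>

lemma diag_mult_vec: "diag d *v x = (\<chi> i. d $ i * x $ i)"
proof -
  have "(\<Sum>j\<in>UNIV. (if i = j then d $ i else 0) * x $ j) = d $ i * x $ i" for i
    by (subst sum.cong[OF refl, of _ _ "\<lambda>j. if i = j then d $ i * x $ j else 0"]) auto
  thus ?thesis by (simp add: matrix_vector_mult_def diag_def)
qed

text \<open>In coordinates the eigenvalue equation reads \<open>(d $ i - \<mu>) * x $ i = 0\<close>
  for every \<open>i\<close>, so eigenvectors are supported where the diagonal entry is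
  \<open>\<mu>\<close>.\<close>

lemma eigenspace_diagonal:
  assumes B: "orthonormal_basis W B" and T: "represented_by B T (diag d)"
  shows "eigenspace W T \<mu> = vec.span (($) B ` {i. d $ i = \<mu>})"
proof -
  have orth: "cinner (B $ i) (B $ j) = (if i = j then 1 else 0)" for i j
    using B by (simp add: orthonormal_basis_def)
  have W: "W = range (lincomb B)"
    using B by (simp add: orthonormal_basis_def span_range_eq_range_lincomb)
  have eigen_iff: "T (lincomb B x) = \<mu> *s lincomb B x \<longleftrightarrow> (\<forall>i. x $ i \<noteq> 0 \<longrightarrow> d $ i = \<mu>)" for x
  proof -
    have "\<mu> *s lincomb B x = lincomb B (\<mu> *s x)"
      by (simp add: lincomb_def vec.scale_sum_right)
    thus ?thesis
      using T unfolding represented_by_def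
      by (simp only: lincomb_eq_iff[OF orth] diag_mult_vec) (auto simp: vec_eq_iff)
  qed
  show ?thesis
  proof
    show "eigenspace W T \<mu> \<subseteq> vec.span (($) B ` {i. d $ i = \<mu>})"
    proof
      fix v assume "v \<in> eigenspace W T \<mu>"
      then obtain x where v: "v = lincomb B x" and x: "\<forall>i. x $ i \<noteq> 0 \<longrightarrow> d $ i = \<mu>"
        by (auto simp: eigenspace_def W eigen_iff)
      have "x $ i *s B $ i \<in> vec.span (($) B ` {i. d $ i = \<mu>})" for i
      proof (cases "x $ i = 0")
        case False
        with x have "B $ i \<in> ($) B ` {i. d $ i = \<mu>}" by blast
        thus ?thesis by (intro vec.span_scale vec.span_base)
      qed (simp add: vec.span_zero)
      thus "v \<in> vec.span (($) B ` {i. d $ i = \<mu>})"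
        unfolding v lincomb_def by (rule vec.span_sum)
    qed
  next
    show "vec.span (($) B ` {i. d $ i = \<mu>}) \<subseteq> eigenspace W T \<mu>"
    proof
      fix v assume v: "v \<in> vec.span (($) B ` {i. d $ i = \<mu>})"
      have "v \<in> vec.span (range (($) B))"
        using v vec.span_mono[of "($) B ` {i. d $ i = \<mu>}" "range (($) B)"] by blast
      then obtain x where x: "v = lincomb B x"
        unfolding span_range_eq_range_lincomb by auto
      \<comment> \<open>The coordinate at \<open>i\<close> is the inner product with
        \<open>B $ i\<close>; if \<open>d $ i \<noteq> \<mu>\<close>, it vanishes on the generators
        and hence on the span.\<close>
      have "d $ i = \<mu>" if "x $ i \<noteq> 0" for i
      proof (rule ccontr)
        assume "d $ i \<noteq> \<mu>"
        hence "vec.span (($) B ` {i. d $ i = \<mu>}) \<subseteq> {v. cinner (B $ i) v = 0}"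
          by (intro vec.span_minimal[OF _ subspace_orthogonal]) (auto simp: orth)
        with v have "cinner (B $ i) v = 0" by blast
        with that show False by (simp add: x cinner_lincomb[OF orth])
      qed
      thus "v \<in> eigenspace W T \<mu>"
        by (auto simp: eigenspace_def W x eigen_iff)
    qed
  qed
qed

lemma dim_eigenspace_diagonal:
  assumes "orthonormal_basis W B" and "represented_by B T (diag d)"
  shows "vec.dim (eigenspace W T \<mu>) = card {i. d $ i = \<mu>}"
  using assms
  by (simp only: eigenspace_diagonal) (rule dim_span_orthonormal, simp add: orthonormal_basis_def)

lemma eigenvalue_on_diagonal:
  assumes "orthonormal_basis W B" and "represented_by B T (diag d)"
  shows "eigenvalue_on W T \<mu> \<longleftrightarrow> (\<exists>i. d $ i = \<mu>)"
proof -
  have orth: "cinner (B $ i) (B $ j) = (if i = j then 1 else 0)" for i j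
    using assms by (simp add: orthonormal_basis_def)
  show ?thesis
  proof
    assume "eigenvalue_on W T \<mu>"
    then obtain x where "x \<in> vec.span (($) B ` {i. d $ i = \<mu>})" "x \<noteq> 0"
      by (auto simp: eigenvalue_on_def eigenspace_diagonal[OF assms])
    \<comment> \<open>An empty index set would span only the zero vector.\<close>
    thus "\<exists>i. d $ i = \<mu>"
      by (cases "{i. d $ i = \<mu>} = {}") auto
  next
    assume "\<exists>i. d $ i = \<mu>"
    then obtain i where "B $ i \<in> eigenspace W T \<mu>"
      by (auto simp: eigenspace_diagonal[OF assms] intro: vec.span_base)
    moreover have "B $ i \<noteq> 0"
      using orth[of i i] by (auto simp: cinner_zero_right)
    ultimately show "eigenvalue_on W T \<mu>"
      by (auto simp: eigenvalue_on_def)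
  qed
qed

lemma largest_eigenvalue_diagonal:
  assumes "orthonormal_basis W B" and "represented_by B T (diag (\<chi> i. complex_of_real (d $ i)))"
  shows "largest_eigenvalue W T = Max (range (($) d))"
proof -
  have "{r. eigenvalue_on W T (complex_of_real r)} = range (($) d)"
    by (auto simp: eigenvalue_on_diagonal[OF assms])
  thus ?thesis by (simp add: largest_eigenvalue_def)
qed

text \<open>Real entries are their own conjugates, so \<open>T\<close> satisfies the defining
  property of its adjoint; definiteness on \<open>W\<close> and extensionality off \<open>W\<close>
  make that solution unique.\<close>

lemma adjoint_on_real_diagonal:
  assumes B: "orthonormal_basis W B"
    and T: "represented_by B T (diag (\<chi> i. complex_of_real (d $ i)))"
    and ext: "T \<in> extensional W"
  shows "adjoint_on W T = T"
  unfolding adjoint_on_def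
proof (rule the_equality)
  have orth: "cinner (B $ i) (B $ j) = (if i = j then 1 else 0)" for i j
    using B by (simp add: orthonormal_basis_def)
  have W: "W = range (lincomb B)"
    using B by (simp add: orthonormal_basis_def span_range_eq_range_lincomb)
  have self_adjoint: "\<forall>x\<in>W. \<forall>y\<in>W. cinner (T x) y = cinner x (T y)"
    using T by (auto simp: W represented_by_def cinner_lincomb_lincomb[OF orth] diag_mult_vec
        mult_ac intro!: sum.cong)
  moreover have "T \<in> W \<rightarrow>\<^sub>E W"
    using T ext by (auto simp: PiE_def W represented_by_def)
  ultimately show "T \<in> W \<rightarrow>\<^sub>E W \<and> (\<forall>x\<in>W. \<forall>y\<in>W. cinner (T x) y = cinner x (T y))" by blast
  fix S assume S: "S \<in> W \<rightarrow>\<^sub>E W \<and> (\<forall>x\<in>W. \<forall>y\<in>W. cinner (S x) y = cinner x (T y))"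
  show "S = T"
  proof (rule extensionalityI[of _ W])
    fix x assume x: "x \<in> W"
    have "vec.subspace W" using B by (auto simp: orthonormal_basis_def)
    moreover have "S x \<in> W" "T x \<in> W" using S \<open>T \<in> W \<rightarrow>\<^sub>E W\<close> x by auto
    \<comment> \<open>The difference lies in \<open>W\<close>, so it may itself serve as the test
      vector \<open>y\<close>.\<close>
    ultimately have "S x - T x \<in> W" by (rule vec.subspace_diff)
    hence "cinner (S x - T x) (S x - T x) = 0"
      using S self_adjoint x by (simp add: cinner_diff_left[of "S x" "T x"])
    thus "S x = T x" by (simp add: cinner_self)
  qed (use S ext in \<open>auto simp: PiE_def\<close>)
qed

text \<open>The dimension of an eigenspace is the number of indices carrying its eigenvalue, which
  is also the multiplicity of that value in the list.\<close>

lemma has_spec_diagonal: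
  assumes B: "orthonormal_basis W B"
    and T: "represented_by B T (diag (\<chi> i. complex_of_real (d $ i)))"
    and sorted: "sorted [d $ 1, d $ 2, d $ 3]"
  shows "has_spec W T [d $ 1, d $ 2, d $ 3]"
proof -
  have orth: "cinner (B $ i) (B $ j) = (if i = j then 1 else 0)" for i j
    using B by (simp add: orthonormal_basis_def)
  have "vec.dim W = 3"
    using B dim_span_orthonormal[OF orth, of UNIV] by (simp add: orthonormal_basis_def)
  moreover have "card {i. complex_of_real (d $ i) = \<mu>} =
      count_list (map complex_of_real [d $ 1, d $ 2, d $ 3]) \<mu>" for \<mu>
  proof -
    have "card {i. complex_of_real (d $ i) = \<mu>} =
        (\<Sum>i\<in>UNIV. if complex_of_real (d $ i) = \<mu> then 1 else 0)"
      by (simp add: sum.If_cases)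
    thus ?thesis by (simp add: sum_3)
  qed
  ultimately show ?thesis
    using sorted dim_eigenspace_diagonal[OF B T] by (simp add: has_spec_def)
qed

section \<open>Symmetrized basis tensors\<close>

text \<open>Expanding the product of three coordinate sums gives one sum over all index
  functions.\<close>

lemma cinner_tensor: "cinner (tensor u) (tensor v) = (\<Prod>k\<in>UNIV. cinner (u $ k) (v $ k))"
  unfolding cinner_def tensor_def
  by (subst prod_sum_PiE) (simp_all add: PiE_UNIV_domain prod.distrib)

text \<open>Permuting the index by \<open>\<sigma>\<close> moves the vectors by the inverse, as
  reindexing the product over the factors shows.\<close>

lemma permute_tensor_tensor:
  assumes "\<sigma> permutes UNIV"
  shows "permute_tensor \<sigma> (tensor v) = tensor (\<chi> k. v $ inv \<sigma> k)"
proof -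
  have "(\<Prod>k\<in>UNIV. v $ k $ i (\<sigma> k)) = (\<Prod>k\<in>UNIV. v $ inv \<sigma> k $ i k)" for i :: "3 \<Rightarrow> 3"
    by (subst prod.permute[OF assms, of "\<lambda>k. v $ inv \<sigma> k $ i k"])
       (simp add: permutes_inverses[OF assms])
  thus ?thesis by (simp add: permute_tensor_def tensor_def vec_eq_iff)
qed

lemma symmetrize_tensor:
  "symmetrize (tensor v) = (1 / fact 3) *s (\<Sum>\<sigma> | \<sigma> permutes UNIV. tensor (\<chi> k. v $ \<sigma> k))"
proof -
  have "(\<Sum>\<sigma> | \<sigma> permutes UNIV. permute_tensor \<sigma> (tensor v)) =
      (\<Sum>\<sigma> | \<sigma> permutes UNIV. tensor (\<chi> k. v $ inv \<sigma> k))"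
    by (rule sum.cong) (auto simp: permute_tensor_tensor)
  also have "\<dots> = (\<Sum>\<sigma> | \<sigma> permutes UNIV. tensor (\<chi> k. v $ \<sigma> k))"
    by (rule sum_permutations_inverse[symmetric])
  finally show ?thesis by (simp add: symmetrize_def)
qed

lemma permute_tensor_linear: "Vector_Spaces.linear (*s) (*s) (permute_tensor \<sigma>)"
  by unfold_locales (simp_all add: permute_tensor_def vec_eq_iff)

text \<open>Left composition with \<open>\<sigma>\<close> is a bijection of the permutations, so it
  only reorders the summands.\<close>

lemma symmetrize_in_Sym3: "symmetrize t \<in> Sym3"
proof -
  have "permute_tensor \<sigma> (symmetrize t) = symmetrize t" if \<sigma>: "\<sigma> permutes UNIV" for \<sigma>
  proof -
    interpret p: Vector_Spaces.linear "(*s)" "(*s)" "permute_tensor \<sigma>"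
      by (rule permute_tensor_linear)
    have "permute_tensor \<sigma> (symmetrize t) =
        (1 / fact 3) *s (\<Sum>\<tau> | \<tau> permutes UNIV. permute_tensor \<sigma> (permute_tensor \<tau> t))"
      by (simp add: symmetrize_def p.scale p.sum)
    also have "\<dots> = (1 / fact 3) *s (\<Sum>\<tau> | \<tau> permutes UNIV. permute_tensor (\<sigma> \<circ> \<tau>) t)"
      by (simp add: permute_tensor_def o_assoc)
    also have "\<dots> = symmetrize t"
      unfolding symmetrize_def
      by (subst setum_permutations_compose_left[OF \<sigma>]) (simp add: o_def)
    finally show ?thesis .
  qed
  thus ?thesis by (simp add: Sym3_def)
qed

lemma subspace_Sym3: "vec.subspace Sym3"
  by (simp add: vec.subspace_def Sym3_def permute_tensor_def vec_eq_iff)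

lemma tensor_power3_linear: "Vector_Spaces.linear (*s) (*s) (tensor_power3 X)"
  by unfold_locales
     (simp_all add: tensor_power3_def vec.scale_left_distrib sum.distrib vec.scale_sum_right)

lemma X_op_linear: "Vector_Spaces.linear (*s) (*s) (X_op f E)"
  by unfold_locales
     (simp_all add: X_op_def ketbra_def cinner_add_right cinner_scale_right vec_eq_iff algebra_simps)

text \<open>Indexing the nodes by mode turns the eigenvalue of a basis tensor into a single product
  over the factors.\<close>

definition node :: "sector \<Rightarrow> real^3" where
  "node f = vector [node_a f, node_b f, node_c f]"

text \<open>Occupation numbers are replaced by an assignment \<open>g\<close> of modes to tensor
  factors, on which permutations act by composition.\<close>

definition normalized_sym :: "(complex^3)^3 \<Rightarrow> (3 \<Rightarrow> 3) \<Rightarrow> tensor3" where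
  "normalized_sym E g = (let t = symmetrize (tensor (\<chi> k. E $ g k)) in t /\<^sub>R norm t)"

lemma occ_state_eq_normalized_sym:
  "occ_state E 2 1 0 = normalized_sym E (($) (vector [1, 1, 2]))"
  "occ_state E 1 1 1 = normalized_sym E (($) (vector [1, 2, 3]))"
  "occ_state E 0 0 3 = normalized_sym E (($) (vector [3, 3, 3]))"
  "occ_state E 0 2 1 = normalized_sym E (($) (vector [2, 2, 3]))"
proof -
  have "vector [E $ i, E $ j, E $ k] = (\<chi> l. E $ ((vector [i, j, k] :: 3^3) $ l))" for i j k
    by (simp add: vec_eq_iff forall_3)
  thus
    "occ_state E 2 1 0 = normalized_sym E (($) (vector [1, 1, 2]))"
    "occ_state E 1 1 1 = normalized_sym E (($) (vector [1, 2, 3]))"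
    "occ_state E 0 0 3 = normalized_sym E (($) (vector [3, 3, 3]))"
    "occ_state E 0 2 1 = normalized_sym E (($) (vector [2, 2, 3]))"
    by (simp_all add: occ_state_def normalized_sym_def numeral_2_eq_2 numeral_3_eq_3)
qed

lemma normalized_sym_in_Sym3: "normalized_sym E g \<in> Sym3"
  unfolding normalized_sym_def Let_def scaleR_eq_scale
  by (rule vec.subspace_scale[OF subspace_Sym3 symmetrize_in_Sym3])

section \<open>Symmetrized tensors over an orthonormal one-particle basis\<close>

context
  fixes E :: "(complex^3)^3"
  assumes E: "orthonormal_basis UNIV E"
begin

lemma cinner_basis_tensor:
  "cinner (tensor (\<chi> k. E $ g k)) (tensor (\<chi> k. E $ h k)) = (if g = h then 1 else 0)"
proof (cases "g = h")
  case False
  then obtain k where "g k \<noteq> h k" by auto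
  hence "\<exists>k\<in>UNIV. cinner (E $ g k) (E $ h k) = 0"
    using E unfolding orthonormal_basis_def by (intro bexI[of _ k]) simp_all
  hence "(\<Prod>k\<in>UNIV. cinner (E $ g k) (E $ h k)) = 0"
    by (rule prod_zero[OF finite])
  with False show ?thesis by (simp add: cinner_tensor)
qed (use E in \<open>simp add: cinner_tensor orthonormal_basis_def\<close>)

text \<open>Pairing with the unsymmetrized tensor counts, up to the factor
  \<open>1 / fact 3\<close>, the permutations that fix \<open>g\<close>; the identity is one of
  them. Hence the normalization never divides by zero.\<close>

lemma symmetrize_basis_tensor_neq_0: "symmetrize (tensor (\<chi> k. E $ g k)) \<noteq> 0"
proof
  assume 0: "symmetrize (tensor (\<chi> k. E $ g k)) = 0"
  let ?S = "{\<sigma>. \<sigma> permutes UNIV \<and> g = g \<circ> \<sigma>}"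
  have "0 = cinner (tensor (\<chi> k. E $ g k)) (symmetrize (tensor (\<chi> k. E $ g k)))"
    by (simp add: 0 cinner_zero_right)
  also have "\<dots> = 1 / fact 3 * (\<Sum>\<sigma> | \<sigma> permutes UNIV. if g = g \<circ> \<sigma> then 1 else 0)"
    by (simp add: symmetrize_tensor cinner_scale_right cinner_sum_right cinner_basis_tensor o_def)
  also have "\<dots> = 1 / fact 3 * of_nat (card ?S)"
    by (simp add: sum.If_cases Collect_conj_eq)
  finally have "card ?S = 0" by simp
  hence "?S = {}" by (rule card_0_eq[OF finite, THEN iffD1])
  moreover have "id \<in> ?S" by (simp add: permutes_id)
  ultimately show False by blast
qed

lemma cinner_normalized_sym_self: "cinner (normalized_sym E g) (normalized_sym E g) = 1"
  by (simp add: cinner_self normalized_sym_def Let_def symmetrize_basis_tensor_neq_0)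

text \<open>Permuting the factors preserves the set of occupied modes, so the two symmetrizations
  share no basis tensor.\<close>

lemma cinner_normalized_sym_orthogonal:
  assumes "range g \<noteq> range h"
  shows "cinner (normalized_sym E g) (normalized_sym E h) = 0"
proof -
  have "g \<circ> \<sigma> \<noteq> h \<circ> \<tau>" if "\<sigma> permutes UNIV" "\<tau> permutes UNIV" for \<sigma> \<tau>
    using that assms by (metis image_comp permutes_image)
  hence "cinner (symmetrize (tensor (\<chi> k. E $ g k))) (symmetrize (tensor (\<chi> k. E $ h k))) = 0"
    by (simp add: symmetrize_tensor cinner_scale_right cinner_scale_left cinner_sum_right
        cinner_sum_left cinner_basis_tensor o_def)
  thus ?thesis
    by (simp add: normalized_sym_def Let_def scaleR_eq_scale cinner_scale_right cinner_scale_left)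
qed

lemma X_op_basis: "X_op f E (E $ i) = complex_of_real (node f $ i) *s E $ i"
  using E exhaust_3[of i]
  by (auto simp: X_op_def ketbra_def orthonormal_basis_def node_def)

lemma tensor_power3_basis_tensor:
  "tensor_power3 (X_op f E) (tensor (\<chi> k. E $ g k)) =
    complex_of_real (\<Prod>k\<in>UNIV. node f $ g k) *s tensor (\<chi> k. E $ g k)"
  by (simp add: tensor_power3_tensor[OF X_op_linear] X_op_basis)
     (simp add: tensor_def vec_eq_iff prod.distrib)

text \<open>All summands of the symmetrization have the same eigenvalue, since a product of nodes
  does not depend on the order of the factors.\<close>

lemma Gamma3_normalized_sym:
  "Gamma3 (X_op f E) (normalized_sym E g) =
    complex_of_real (\<Prod>k\<in>UNIV. node f $ g k) *s normalized_sym E g"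
proof -
  interpret p: Vector_Spaces.linear "(*s)" "(*s)" "tensor_power3 (X_op f E)"
    by (rule tensor_power3_linear)
  let ?c = "complex_of_real (\<Prod>k\<in>UNIV. node f $ g k)"
  have "tensor_power3 (X_op f E) (tensor (\<chi> k. E $ g (\<sigma> k))) = ?c *s tensor (\<chi> k. E $ g (\<sigma> k))"
    if "\<sigma> permutes UNIV" for \<sigma>
    \<comment> \<open>The eigenvalue found for \<open>g \<circ> \<sigma>\<close> is reindexed back
      to the one for \<open>g\<close>.\<close>
    using tensor_power3_basis_tensor[of f "g \<circ> \<sigma>"] prod.permute[OF that, of "\<lambda>k. node f $ g k"]
    by (simp add: o_def)
  hence "tensor_power3 (X_op f E) (symmetrize (tensor (\<chi> k. E $ g k))) =
      ?c *s symmetrize (tensor (\<chi> k. E $ g k))"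
    by (simp add: symmetrize_tensor p.scale p.sum vec.scale_sum_right mult.commute)
  thus ?thesis
    using normalized_sym_in_Sym3[of E g]
    by (simp add: Gamma3_def normalized_sym_def Let_def scaleR_eq_scale p.scale mult.commute)
qed

end

section \<open>The occupied space\<close>

fun occ_config :: "sector \<Rightarrow> (3^3)^3" where
  "occ_config Down = vector [vector [1, 1, 2], vector [1, 2, 3], vector [3, 3, 3]]"
| "occ_config Up = vector [vector [1, 1, 2], vector [1, 2, 3], vector [2, 2, 3]]"

lemma occ_basis_nth: "occ_basis f E $ i = normalized_sym E (($) (occ_config f $ i))"
  using exhaust_3[of i] by (cases f) (auto simp: occ_state_eq_normalized_sym simp del: One_nat_def)

text \<open>The occupied modes are \<open>{1, 2}\<close>, \<open>{1, 2, 3}\<close> and then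
  \<open>{3}\<close> for \<open>Down\<close> or \<open>{2, 3}\<close> for \<open>Up\<close>, which
  are pairwise distinct.\<close>

lemma range_occ_config_inj:
  assumes "i \<noteq> j"
  shows "range (($) (occ_config f $ i)) \<noteq> range (($) (occ_config f $ j))"
  using assms exhaust_3[of i] exhaust_3[of j]
  by (elim disjE; cases f; simp only: occ_config.simps vector_3 UNIV_3 set_eq_iff forall_3
      image_insert image_empty insert_iff empty_iff; simp)

lemma prod_UNIV_3: "prod f (UNIV :: 3 set) = f 1 * f 2 * f 3"
  unfolding UNIV_3 by (simp add: mult.assoc)

lemma prod_node_occ_config: "(\<Prod>k\<in>UNIV. node f $ (occ_config f $ i $ k)) = monomials f $ i"
  using exhaust_3[of i] unfolding prod_UNIV_3
  by (elim disjE; cases f; simp only: node_def occ_config.simps monomials.simps vector_3;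
      simp add: power2_eq_square power3_eq_cube)

context
  fixes f :: sector and E :: "(complex^3)^3"
  assumes E: "orthonormal_basis UNIV E"
begin

lemma cinner_occ_basis:
  "cinner (occ_basis f E $ i) (occ_basis f E $ j) = (if i = j then 1 else 0)"
  unfolding occ_basis_nth
  by (cases "i = j")
     (simp_all only: cinner_normalized_sym_self[OF E] if_True if_False refl
       cinner_normalized_sym_orthogonal[OF E range_occ_config_inj] not_False_eq_True)

text \<open>Since \<open>Gamma3\<close> is restricted to \<open>Sym3\<close>, evaluating it on the
  occupied space requires this inclusion.\<close>

lemma lincomb_occ_basis_in_Sym3: "lincomb (occ_basis f E) x \<in> Sym3"
  unfolding lincomb_def
  by (rule vec.subspace_sum[OF subspace_Sym3], rule vec.subspace_scale[OF subspace_Sym3])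
     (simp only: occ_basis_nth normalized_sym_in_Sym3)

lemma P_occ_lincomb: "P_occ f E (lincomb (occ_basis f E) x) = lincomb (occ_basis f E) x"
  unfolding P_occ_def by (rule projection_lincomb[OF cinner_occ_basis])

text \<open>The projector lands in the span of the three states, and it reaches all of that span
  because the span lies in \<open>Sym3\<close> and is fixed pointwise.\<close>

lemma occ_space_eq: "occ_space f E = range (lincomb (occ_basis f E))"
proof
  show "occ_space f E \<subseteq> range (lincomb (occ_basis f E))"
    unfolding occ_space_def P_occ_def projection_eq_lincomb[OF cinner_occ_basis] by auto
  show "range (lincomb (occ_basis f E)) \<subseteq> occ_space f E"
  proof (rule image_subsetI)
    fix x
    show "lincomb (occ_basis f E) x \<in> occ_space f E"
      unfolding occ_space_def
      by (rule image_eqI[where f = "P_occ f E", OF P_occ_lincomb[symmetric]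
            lincomb_occ_basis_in_Sym3])
  qed
qed

lemma orthonormal_basis_occ_space: "orthonormal_basis (occ_space f E) (occ_basis f E)"
  by (simp add: orthonormal_basis_def cinner_occ_basis occ_space_eq span_range_eq_range_lincomb)

text \<open>The three states are eigenvectors, so \<open>Gamma3\<close> keeps the occupied space
  invariant and both projections act there as the identity.\<close>

lemma R_op_represented:
  "represented_by (occ_basis f E) (R_op f E) (diag (\<chi> i. complex_of_real (monomials f $ i)))"
  unfolding represented_by_def
proof
  fix x
  interpret p: Vector_Spaces.linear "(*s)" "(*s)" "tensor_power3 (X_op f E)"
    by (rule tensor_power3_linear)
  \<comment> \<open>Stated for \<open>tensor_power3\<close>, which is linear on the whole tensor
    space, whereas \<open>Gamma3\<close> is \<open>undefined\<close> outside
    \<open>Sym3\<close>.\<close>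
  have basis: "tensor_power3 (X_op f E) (occ_basis f E $ i) =
      complex_of_real (monomials f $ i) *s occ_basis f E $ i" for i
    using Gamma3_normalized_sym[OF E, of f "($) (occ_config f $ i)"]
    by (simp add: Gamma3_def normalized_sym_in_Sym3 occ_basis_nth prod_node_occ_config
        del: of_real_prod)
  have "Gamma3 (X_op f E) (lincomb (occ_basis f E) x) =
      tensor_power3 (X_op f E) (lincomb (occ_basis f E) x)"
    by (simp add: Gamma3_def lincomb_occ_basis_in_Sym3)
  also have "\<dots> = lincomb (occ_basis f E) (diag (\<chi> i. complex_of_real (monomials f $ i)) *v x)"
    by (simp add: lincomb_def p.sum p.scale basis diag_mult_vec mult.commute)
  finally show "R_op f E (lincomb (occ_basis f E) x) =
      lincomb (occ_basis f E) (diag (\<chi> i. complex_of_real (monomials f $ i)) *v x)"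
    by (simp add: R_op_def P_occ_lincomb occ_space_eq)
qed

text \<open>As \<open>R_op\<close> is its own adjoint, \<open>Q_op\<close> is its square divided by
  the square of \<open>rho\<close>. The entries are written in the shape
  \<open>complex_of_real (d $ i)\<close> used by \<open>has_spec_diagonal\<close>.\<close>

lemma Q_op_represented:
  "represented_by (occ_basis f E) (Q_op f E)
    (diag (\<chi> i. complex_of_real ((\<chi> i. (monomials f $ i / rho f E)\<^sup>2) $ i)))"
  unfolding represented_by_def
proof
  fix x
  have "adjoint_on (occ_space f E) (R_op f E) = R_op f E"
    by (rule adjoint_on_real_diagonal[OF orthonormal_basis_occ_space R_op_represented])
       (simp add: R_op_def)
  hence "Q_op f E (lincomb (occ_basis f E) x) =
      complex_of_real (1 / (rho f E)\<^sup>2) *s R_op f E (R_op f E (lincomb (occ_basis f E) x))"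
    by (simp add: Q_op_def occ_space_eq)
  also have "\<dots> = lincomb (occ_basis f E)
      (diag (\<chi> i. complex_of_real ((\<chi> i. (monomials f $ i / rho f E)\<^sup>2) $ i)) *v x)"
    using R_op_represented
    by (simp add: represented_by_def diag_mult_vec)
       (simp add: lincomb_def vec.scale_sum_right power2_eq_square mult_ac divide_simps)
  finally show "Q_op f E (lincomb (occ_basis f E) x) = lincomb (occ_basis f E)
      (diag (\<chi> i. complex_of_real ((\<chi> i. (monomials f $ i / rho f E)\<^sup>2) $ i)) *v x)" .
qed

end

section \<open>Ordering of nodes and monomials, and the mass ratios\<close>

lemma node_order: "0 < node_a f" "node_a f < node_b f" "node_b f < node_c f"
proof -
  have "delta > 0" by (simp add: delta_def)
  \<comment> \<open>This is \<open>3 / 8 < 4 / 9\<close>; the bound is the smaller of the two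
    centres and makes both lowest nodes positive.\<close>
  moreover have "delta < 2 / 3"
    unfolding delta_def by (rule real_less_lsqrt) (simp_all add: power2_eq_square)
  ultimately show "0 < node_a f" "node_a f < node_b f" "node_b f < node_c f"
    by (cases f; simp add: node_a_def node_b_def node_c_def)+
qed

text \<open>Strict growth identifies the largest eigenvalue and puts the spectrum in increasing
  order.\<close>

lemma monomials_order:
  "0 < monomials f $ 1" "monomials f $ 1 < monomials f $ 2" "monomials f $ 2 < monomials f $ 3"
proof -
  note ord = node_order[of f]
  have pos: "0 < node_a f" "0 < node_b f" "0 < node_c f" using ord by linarith+
  show "0 < monomials f $ 1" using pos by (cases f) simp_all
  have "node_a f * node_b f * node_a f < node_a f * node_b f * node_c f"
    by (rule mult_strict_left_mono) (use ord pos in auto)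
  thus "monomials f $ 1 < monomials f $ 2"
    by (cases f) (simp_all add: power2_eq_square mult_ac)
  \<comment> \<open>The first bound settles \<open>Up\<close>, the second \<open>Down\<close>; both
    hold in either sector.\<close>
  have "node_a f * node_b f * node_c f < node_b f * node_b f * node_c f"
    "node_a f * node_b f * node_c f < node_c f * node_c f * node_c f"
    by (intro mult_strict_right_mono mult_strict_mono; use ord pos in linarith)+
  thus "monomials f $ 2 < monomials f $ 3"
    by (cases f) (simp_all add: power2_eq_square power3_eq_cube)
qed

lemma rho_eq:
  assumes "orthonormal_basis UNIV E"
  shows "rho f E = monomials f $ 3"
proof -
  have "rho f E = Max (range (($) (monomials f)))"
    unfolding rho_def
    by (rule largest_eigenvalue_diagonal[OF orthonormal_basis_occ_space[OF assms]
          R_op_represented[OF assms]])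
  also have "\<dots> = monomials f $ 3"
    unfolding UNIV_3 using monomials_order[of f] by (simp del: monomials.simps)
  finally show ?thesis .
qed

theorem proposition1:
  fixes f :: sector and E :: "(complex^3)^3"
  assumes "orthonormal_basis UNIV E"
  shows "orthonormal_basis (occ_space f E) (occ_basis f E) \<and>
    represented_by (occ_basis f E) (R_op f E)
      (diag (\<chi> i. complex_of_real (monomials f $ i))) \<and>
    (\<forall>m :: real^3.
      (\<forall>i. m $ i > 0) \<and> (\<exists>k. \<forall>i. sqrt (m $ i) = k * monomials f $ i) \<longrightarrow>
      has_spec (occ_space f E) (Q_op f E) [m $ 1 / m $ 3, m $ 2 / m $ 3, 1])"
proof (intro conjI allI impI)
  show B: "orthonormal_basis (occ_space f E) (occ_basis f E)"
    by (rule orthonormal_basis_occ_space[OF assms])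
  show "represented_by (occ_basis f E) (R_op f E)
      (diag (\<chi> i. complex_of_real (monomials f $ i)))"
    by (rule R_op_represented[OF assms])
  fix m :: "real^3"
  assume "(\<forall>i. m $ i > 0) \<and> (\<exists>k. \<forall>i. sqrt (m $ i) = k * monomials f $ i)"
  then obtain k where pos: "m $ i > 0" and k: "sqrt (m $ i) = k * monomials f $ i" for i
    by blast
  define d :: "real^3" where "d = (\<chi> i. (monomials f $ i / rho f E)\<^sup>2)"
  \<comment> \<open>Squaring the proportionality gives the masses; the factor
    \<open>k\<^sup>2\<close> then cancels from every ratio, \<open>k\<close> being nonzero because
    the masses are positive.\<close>
  have "m $ i = (k * monomials f $ i)\<^sup>2" for i
    using pos[of i] by (simp flip: k)
  moreover have "k \<noteq> 0" using k[of 1] pos[of 1] by auto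
  ultimately have d: "m $ i / m $ 3 = d $ i" for i
    by (simp add: d_def rho_eq[OF assms] power_mult_distrib power_divide)
  note ord = monomials_order[of f]
  \<comment> \<open>Squaring preserves the order because the monomials are positive.\<close>
  have "d $ 1 \<le> d $ 2" "d $ 2 \<le> d $ 3"
    unfolding d_def rho_eq[OF assms] vec_lambda_beta
    by (intro power_mono divide_right_mono divide_nonneg_nonneg; use ord in linarith)+
  hence "sorted [d $ 1, d $ 2, d $ 3]" by simp
  hence "has_spec (occ_space f E) (Q_op f E) [d $ 1, d $ 2, d $ 3]"
    using Q_op_represented[OF assms] by (intro has_spec_diagonal[OF B]) (simp_all add: d_def)
  moreover have "d $ 3 = 1" using d[of 3] pos[of 3] by simp
  ultimately show "has_spec (occ_space f E) (Q_op f E) [m $ 1 / m $ 3, m $ 2 / m $ 3, 1]"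
    by (simp add: d)
qed

end
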